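(* Let $\mathcal{K}$ be a finite nonempty set of nonnegative $N\times N$ matrices that satisfies the product property. Then there exists $B\in\mathcal{K}$ such that $B^nv\preceq A^nv$ for every $A\in\mathcal{K}$ and every strictly positive vector $v\in\mathbb{R}^N$.
   Context: Vector inequalities are component-wise; a vector $v$ is strictly positive if all its components are positive. Product property: $\mathcal{K}$ satisfies the product property if for every $V\subseteq \{1,\ldots,N\}$ and all $A,B\in\mathcal{K}$, the matrix whose $i$th row is the $i$th row of $A$ for $i\in V$ and the $i$th row of $B$ for $i\notin V$ belongs to $\mathcal{K}$. Growth: for sequences $a_n,b_n$ of nonnegative vectors of the same dimension, $a_n\preceq b_n$ means that there is a constant $q>0$ with $a_n\le q\,b_n$ for all $n$ large enough. *)

theory Defs
  imports Jordan_Normal_Form.Matrix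
begin

text \<open>
  Vectors and matrices are indexed from 0, so the index set \<open>{1,\<dots>,N}\<close> becomes \<open>{..<N}\<close>.
  On vectors, \<open>\<le>\<close> is the component-wise order (it includes equality of the dimensions), but the
  derived \<open><\<close> only means \<open>\<le>\<close> without equality; strict positivity is therefore defined separately.
\<close>

definition nonneg_mat :: "real mat \<Rightarrow> bool" where
  "nonneg_mat A \<longleftrightarrow> (\<forall>i < dim_row A. \<forall>j < dim_col A. 0 \<le> A $$ (i, j))"

definition strictly_positive_vec :: "real vec \<Rightarrow> bool" where
  "strictly_positive_vec v \<longleftrightarrow> (\<forall>i < dim_vec v. 0 < v $ i)"

definition product_property :: "nat \<Rightarrow> real mat set \<Rightarrow> bool" where
  "product_property N K \<longleftrightarrow>
     (\<forall>V \<subseteq> {..<N}. \<forall>A \<in> K. \<forall>B \<in> K.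
        mat\<^sub>r N N (\<lambda>i. if i \<in> V then row A i else row B i) \<in> K)"

text \<open>Meant for sequences of nonnegative vectors of one common dimension.\<close>

definition growth_le :: "(nat \<Rightarrow> real vec) \<Rightarrow> (nat \<Rightarrow> real vec) \<Rightarrow> bool" (infix "\<preceq>" 50) where
  "a \<preceq> b \<longleftrightarrow> (\<exists>q > 0. eventually (\<lambda>n. a n \<le> q \<cdot>\<^sub>v b n) sequentially)"

end

theory Submission
  imports Defs Jordan_Normal_Form.Jordan_Normal_Form_Existence "HOL-Real_Asymp.Real_Asymp"
begin

text \<open>
  Write \<open>a\<^sub>i(n)\<close> and \<open>b\<^sub>i(n)\<close> for the \<open>i\<close>th row sums of \<open>A\<^sup>n\<close> and \<open>B\<^sup>n\<close>. By the Jordan normal form, every such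
  sequence is eventually zero or of exact order \<open>n\<^sup>d r\<^sup>n\<close>, so for each \<open>i\<close> either \<open>a\<^sub>i = o(b\<^sub>i)\<close> or \<open>b\<^sub>i = O(a\<^sub>i)\<close>.
  Let \<open>C\<close> take its rows from \<open>A\<close> in the first case and from \<open>B\<close> in the second. Set \<open>m\<^sub>i = a\<^sub>i\<close> in the first case
  and \<open>m\<^sub>i = \<epsilon> b\<^sub>i\<close> in the second. For small \<open>\<epsilon>\<close> and large \<open>n\<close> we have \<open>m \<le> a\<close> and \<open>m \<le> \<epsilon> b\<close>, hence
  \<open>C m(n) \<le> m(n + 1)\<close>, and so the row sums of \<open>C\<^sup>n\<close> grow at most as fast as both \<open>a\<close> and \<open>b\<close>. Thus \<open>\<K>\<close> is
  directed downwards under growth, and being finite it has a least element.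
\<close>

section \<open>Sequences of polynomial times geometric order\<close>

definition pow_growth :: "nat \<Rightarrow> real \<Rightarrow> nat \<Rightarrow> real" where
  "pow_growth d r = (\<lambda>n. real n ^ d * r ^ n)"

text \<open>The eventually zero case stands apart because nilpotent behaviour is not of order
  \<open>pow_growth d r\<close> for any \<open>r > 0\<close>.\<close>

definition regular_growth :: "(nat \<Rightarrow> real) \<Rightarrow> bool" where
  "regular_growth f \<longleftrightarrow>
     eventually (\<lambda>n. f n = 0) sequentially \<or> (\<exists>d. \<exists>r>0. f \<in> \<Theta>(pow_growth d r))"

lemma power_mono_bigo:
  assumes "e \<le> d"
  shows "(\<lambda>n. real n ^ e) \<in> O(\<lambda>n. real n ^ d)"
proof (rule bigoI[of _ 1])
  show "eventually (\<lambda>n. norm (real n ^ e) \<le> 1 * norm (real n ^ d)) sequentially"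
    using eventually_ge_at_top[of 1] by eventually_elim (simp add: assms power_increasing)
qed

text \<open>The gap \<open>c = ln s - ln r\<close> is positive, and
  \<open>exp (- (c * real n))\<close> beats every power of n. The factor \<open>real n ^ e\<close>
  on the right only helps.\<close>

lemma pow_growth_smallo:
  assumes "0 < r" "r < s"
  shows "pow_growth d r \<in> o(pow_growth e s)"
proof -
  define c where "c = ln s - ln r"
  have "c > 0" using assms by (simp add: c_def)
  then have "(\<lambda>n. real n ^ d * exp (- (c * real n))) \<longlonglongrightarrow> 0" by real_asymp
  moreover have "real n ^ d * exp (- (c * real n)) = pow_growth d r n / s ^ n" for n
    using assms unfolding c_def pow_growth_def
    by (simp add: algebra_simps exp_diff exp_of_nat_mult)
  ultimately have "(\<lambda>n. pow_growth d r n / s ^ n) \<longlonglongrightarrow> 0" by simp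
  then have "pow_growth d r \<in> o(\<lambda>n. s ^ n)"
    using assms by (intro smalloI_tendsto) auto
  also have "(\<lambda>n. s ^ n) \<in> O(pow_growth e s)"
    using landau_o.big.mult[OF power_mono_bigo[of 0 e] landau_o.big_refl[of "\<lambda>n. s ^ n"]]
    unfolding pow_growth_def by simp
  finally show ?thesis .
qed

text \<open>Orders compare lexicographically: first the rate, then the degree.\<close>

lemma pow_growth_total:
  assumes "r > 0" "s > 0"
  shows "pow_growth d r \<in> o(pow_growth e s) \<or> pow_growth e s \<in> O(pow_growth d r)"
proof -
  consider "r < s" | "s < r" | "r = s" "d < e" | "r = s" "e \<le> d" by linarith
  then show ?thesis
  proof cases
    case 1
    then show ?thesis using assms pow_growth_smallo by blast
  next
    case 2
    then show ?thesis using assms pow_growth_smallo landau_o.small_imp_big by blast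
  next
    case 3
    have "(\<lambda>n. real n ^ d) \<in> o(\<lambda>n. real n ^ e)" using \<open>d < e\<close> by real_asymp
    then show ?thesis using 3 assms unfolding pow_growth_def by simp
  next
    case 4
    then show ?thesis using power_mono_bigo 4 assms unfolding pow_growth_def by simp
  qed
qed

text \<open>This dichotomy is what regularity is for; sequences with an oscillating ratio can
  violate it.\<close>

lemma regular_growth_total:
  assumes "regular_growth f" "regular_growth g"
  shows "f \<in> o(g) \<or> g \<in> O(f)"
proof -
  have ?thesis if "eventually (\<lambda>n. f n = 0) sequentially"
  proof -
    have "f \<in> o(g)" using that
      by (intro landau_o.smallI) (auto elim!: eventually_mono)
    then show ?thesis ..
  qed
  moreover have ?thesis if "eventually (\<lambda>n. g n = 0) sequentially"
  proof -
    have "g \<in> O(f)" using that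
      by (intro landau_o.bigI[of 1]) (auto elim!: eventually_mono)
    then show ?thesis ..
  qed
  moreover have ?thesis if f: "r > 0" "f \<in> \<Theta>(pow_growth d r)" and g: "s > 0" "g \<in> \<Theta>(pow_growth e s)"
    for d r e s
    using pow_growth_total[OF \<open>r > 0\<close> \<open>s > 0\<close>, of d e]
      landau_o.small.cong_bigtheta[OF g(2)] landau_o.small.in_cong_bigtheta[OF f(2)]
      landau_o.big.cong_bigtheta[OF f(2)] landau_o.big.in_cong_bigtheta[OF g(2)]
    by blast
  ultimately show ?thesis using assms unfolding regular_growth_def by blast
qed

lemma regular_growth_cong_bigtheta:
  assumes "f \<in> \<Theta>(g)" "regular_growth g"
  shows "regular_growth f"
proof (cases "eventually (\<lambda>n. g n = 0) sequentially")
  case True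
  then show ?thesis
    using bigthetaD1[OF assms(1)] unfolding regular_growth_def
    by (auto elim!: landau_o.bigE elim: eventually_elim2)
next
  case False
  then obtain d r where "r > 0" "g \<in> \<Theta>(pow_growth d r)"
    using assms(2) unfolding regular_growth_def by blast
  with assms(1) show ?thesis
    unfolding regular_growth_def using landau_theta.trans by blast
qed

text \<open>Nonnegativity rules out cancellation, so the sum has the order of its dominant
  summand.\<close>

lemma regular_growth_add:
  assumes f: "regular_growth f" and g: "regular_growth g"
    and nonneg: "\<And>n. 0 \<le> f n" "\<And>n. 0 \<le> g n"
  shows "regular_growth (\<lambda>n. f n + g n)"
proof -
  have *: "(\<lambda>n. f n + g n) \<in> \<Theta>(f)" if "g \<in> O(f)" "\<And>n. 0 \<le> f n" "\<And>n. 0 \<le> g n"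
    for f g :: "nat \<Rightarrow> real"
  proof (rule bigthetaI)
    show "(\<lambda>n. f n + g n) \<in> O(f)" using that(1) by (intro sum_in_bigo) auto
    show "(\<lambda>n. f n + g n) \<in> \<Omega>(f)"
      using that(2,3) by (intro landau_omega.bigI[of 1]) auto
  qed
  show ?thesis
  proof (cases "g \<in> O(f)")
    case True
    then show ?thesis using regular_growth_cong_bigtheta[OF * f] nonneg by blast
  next
    case False
    then have "f \<in> O(g)"
      using regular_growth_total[OF f g] landau_o.small_imp_big by blast
    then show ?thesis using regular_growth_cong_bigtheta[OF * g] nonneg by (simp add: add.commute)
  qed
qed

section \<open>Asymptotics of binomial coefficients\<close>

lemma binomial_over_power_tendsto:
  "(\<lambda>n. real (n choose k) / real n ^ k) \<longlonglongrightarrow> 1 / fact k"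
proof (induction k)
  case (Suc k)
  have "(\<lambda>n. real (n choose k) / real n ^ k * ((1 - real k / real n) / real (Suc k)))
    \<longlonglongrightarrow> 1 / fact k * ((1 - 0) / real (Suc k))"
    by (intro tendsto_intros Suc.IH lim_const_over_n) auto
  \<comment> \<open>The factor is the ratio of consecutive binomial coefficients divided by n; for
    \<open>n > k\<close> the truncated \<open>n - k\<close> is the real difference.\<close>
  moreover have "eventually (\<lambda>n. real (n choose k) / real n ^ k * ((1 - real k / real n) / real (Suc k)) =
      real (n choose Suc k) / real n ^ Suc k) sequentially"
    using eventually_gt_at_top[of k]
  proof eventually_elim
    case (elim n)
    have "real (Suc k) * real (n choose Suc k) = real (n - k) * real (n choose k)"
      by (metis binomial_absorb_comp binomial_absorption mult.commute of_nat_mult)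
    with elim have eq: "real (n choose Suc k) = real (n choose k) * (real n - real k) / real (Suc k)"
      by (simp add: eq_divide_eq mult_ac of_nat_diff del: binomial_Suc_Suc)
    from elim show ?case unfolding eq by (simp add: field_simps)
  qed
  ultimately show ?case by (simp add: Lim_transform_eventually mult.commute)
qed simp

text \<open>Normalising by a common power keeps only the coefficient of full degree; the entries of
  powers of a Jordan block are compared in this way.\<close>

lemma binomial_over_power_tendsto':
  assumes "k \<le> d"
  shows "(\<lambda>n. real (n choose k) / real n ^ d) \<longlonglongrightarrow> (if k = d then 1 / fact d else 0)"
proof (cases "k = d")
  case True
  then show ?thesis using binomial_over_power_tendsto by simp
next
  case False
  with assms have "d - k > 0" by simp
  then have "(\<lambda>n. 1 / real n ^ (d - k)) \<longlonglongrightarrow> 0" by real_asymp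
  from tendsto_mult[OF binomial_over_power_tendsto[of k] this] False assms show ?thesis
    by (simp flip: power_add)
qed

section \<open>Orbits of complex matrices\<close>

text \<open>The l1 norm is chosen because it is additive over blocks and a plain sum on nonnegative
  vectors.\<close>

definition sum_norm :: "complex vec \<Rightarrow> real" where
  "sum_norm x = (\<Sum>i<dim_vec x. norm (x $ i))"

lemma sum_norm_nonneg: "0 \<le> sum_norm x"
  unfolding sum_norm_def by (simp add: sum_nonneg)

lemma sum_norm_append: "sum_norm (x @\<^sub>v y) = sum_norm x + sum_norm y"
proof -
  have "sum_norm (x @\<^sub>v y) = (\<Sum>i<dim_vec x. norm ((x @\<^sub>v y) $ i))
      + (\<Sum>i=dim_vec x..<dim_vec x + dim_vec y. norm ((x @\<^sub>v y) $ i))"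
    unfolding sum_norm_def index_append_vec(2) lessThan_atLeast0
    by (subst sum.atLeastLessThan_concat) auto
  also have "(\<Sum>i=dim_vec x..<dim_vec x + dim_vec y. norm ((x @\<^sub>v y) $ i)) = sum_norm y"
    unfolding sum_norm_def lessThan_atLeast0
    using sum.shift_bounds_nat_ivl[of "\<lambda>i. norm ((x @\<^sub>v y) $ i)" 0 "dim_vec x" "dim_vec y"]
    by (simp add: add.commute)
  also have "(\<Sum>i<dim_vec x. norm ((x @\<^sub>v y) $ i)) = sum_norm x"
    unfolding sum_norm_def by simp
  finally show ?thesis .
qed

text \<open>The sum of the norms of all entries of P serves for every x, so one constant works along
  a whole orbit.\<close>

lemma sum_norm_mult_mat_vec_le:
  assumes "P \<in> carrier_mat n n"
  obtains c where "\<And>x. x \<in> carrier_vec n \<Longrightarrow> sum_norm (P *\<^sub>v x) \<le> c * sum_norm x"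
proof
  fix x :: "complex vec" assume x: "x \<in> carrier_vec n"
  have "sum_norm (P *\<^sub>v x) = (\<Sum>i<n. norm (\<Sum>j<n. P $$ (i,j) * x $ j))"
    using assms x unfolding sum_norm_def by (simp add: scalar_prod_def lessThan_atLeast0)
  also have "\<dots> \<le> (\<Sum>i<n. \<Sum>j<n. norm (P $$ (i,j)) * norm (x $ j))"
    by (intro sum_mono order_trans[OF norm_sum]) (simp add: norm_mult)
  also have "\<dots> \<le> (\<Sum>i<n. \<Sum>j<n. norm (P $$ (i,j)) * sum_norm x)"
    using x unfolding sum_norm_def
    by (intro sum_mono mult_left_mono member_le_sum) auto
  also have "\<dots> = (\<Sum>i<n. \<Sum>j<n. norm (P $$ (i,j))) * sum_norm x"
    by (simp add: sum_distrib_right)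
  finally show "sum_norm (P *\<^sub>v x) \<le> (\<Sum>i<n. \<Sum>j<n. norm (P $$ (i,j))) * sum_norm x" .
qed

text \<open>A nilpotent block or a zero vector makes the norm eventually zero. Otherwise the norm
  divided by \<open>pow_growth d (norm a)\<close>, for a suitable d, has a positive limit.\<close>

lemma regular_growth_jordan_block:
  fixes a :: complex
  assumes y: "y \<in> carrier_vec m"
  shows "regular_growth (\<lambda>n. sum_norm (jordan_block m a ^\<^sub>m n *\<^sub>v y))"
proof -
  let ?f = "\<lambda>n. sum_norm (jordan_block m a ^\<^sub>m n *\<^sub>v y)"
  consider "a = 0" | "\<forall>j<m. y $ j = 0" | "a \<noteq> 0" "\<exists>j<m. y $ j \<noteq> 0" by blast
  then show ?thesis
  proof cases
    case 1
    have "eventually (\<lambda>n. ?f n = 0) sequentially"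
      using eventually_ge_at_top[of m]
    proof eventually_elim
      case (elim n)
      with y show ?case
        unfolding sum_norm_def 1 jordan_block_zero_pow
        by (auto simp: scalar_prod_def intro!: sum.neutral)
    qed
    then show ?thesis unfolding regular_growth_def by blast
  next
    case 2
    then have "?f n = 0" for n
      using y unfolding sum_norm_def by (auto simp: scalar_prod_def intro!: sum.neutral)
    then show ?thesis unfolding regular_growth_def by simp
  next
    case 3
    txt \<open>The last nonzero coordinate of \<open>y\<close> determines the order, which is attained in coordinate \<open>0\<close>.\<close>
    define d where "d = Max {j. j < m \<and> y $ j \<noteq> 0}"
    have "d \<in> {j. j < m \<and> y $ j \<noteq> 0}"
      unfolding d_def using 3(2) by (intro Max_in) auto
    then have d: "d < m" "y $ d \<noteq> 0" by auto
    have "j \<le> d" if "j < m" "y $ j \<noteq> 0" for j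
      unfolding d_def using that by (intro Max_ge) auto
    then have d_max: "y $ j = 0" if "d < j" "j < m" for j
      using that by fastforce
    \<comment> \<open>\<open>T i j n\<close> is the contribution of coordinate j of y to coordinate
      i. If \<open>n + i < j\<close>, the truncated exponent is harmless, since then
      \<open>n choose (j - i)\<close> is 0.\<close>
    define T where "T i j n = (if i \<le> j then of_nat (n choose (j - i)) * a ^ (n + i - j) else 0) * y $ j"
      for i j n
    \<comment> \<open>Dividing by the complex \<open>a ^ n\<close> rather than its modulus cancels
      the rotating phase, so that the quotients converge.\<close>
    define w where "w n = of_nat n ^ d * a ^ n" for n
    define L where "L = y $ d / (fact d * a ^ d)"
    have f: "?f n = (\<Sum>i<m. norm (\<Sum>j<m. T i j n))" for n
      using y unfolding sum_norm_def jordan_block_pow T_def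
      by (simp add: scalar_prod_def lessThan_atLeast0)
    \<comment> \<open>Full degree requires \<open>j - i = d\<close> with \<open>j \<le> d\<close>,
      hence \<open>j = d\<close> and \<open>i = 0\<close>; all other terms vanish in the
      limit.\<close>
    have T: "(\<lambda>n. T i j n / w n) \<longlonglongrightarrow> (if j = d then if i = 0 then L else 0 else 0)" if "j < m" for i j
    proof (cases "i \<le> j \<and> j \<le> d")
      case True
      have "(\<lambda>n. of_real (real (n choose (j - i)) / real n ^ d) * (a ^ i * y $ j / a ^ j))
        \<longlonglongrightarrow> of_real (if j - i = d then 1 / fact d else 0) * (a ^ i * y $ j / a ^ j)"
        using True by (intro tendsto_intros binomial_over_power_tendsto') auto
      moreover have "eventually (\<lambda>n. of_real (real (n choose (j - i)) / real n ^ d) * (a ^ i * y $ j / a ^ j)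
          = T i j n / w n) sequentially"
        using eventually_ge_at_top[of j]
      proof eventually_elim
        case (elim n)
        then have "a ^ (n + i - j) = a ^ n * a ^ i / a ^ j"
          using \<open>a \<noteq> 0\<close> by (simp add: power_diff power_add)
        then show ?case
          unfolding T_def w_def using True \<open>a \<noteq> 0\<close> by simp
      qed
      moreover have "of_real (if j - i = d then 1 / fact d else 0) * (a ^ i * y $ j / a ^ j)
          = (if j = d then if i = 0 then L else 0 else 0)"
        using True d(1) unfolding L_def by auto
      ultimately show ?thesis by (simp add: Lim_transform_eventually)
    next
      case False
      then have "T i j n = 0" for n
        unfolding T_def using d_max[of j] \<open>j < m\<close> by auto
      moreover have "(if j = d then if i = 0 then L else 0 else 0) = 0"
        using False by auto
      ultimately show ?thesis by simp
    qed
    have "(\<lambda>n. \<Sum>i<m. norm (\<Sum>j<m. T i j n / w n)) \<longlonglongrightarrow>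
        (\<Sum>i<m. norm (\<Sum>j<m. if j = d then if i = 0 then L else 0 else 0))"
      using T by (intro tendsto_intros) auto
    also have "(\<Sum>i<m. norm (\<Sum>j<m. if j = d then if i = 0 then L else 0 else 0)) = (\<Sum>i<m. if i = 0 then norm L else 0)"
      using d(1) by (intro sum.cong) (auto simp: sum.delta)
    also have "\<dots> = norm L" using d(1) by (simp add: sum.delta)
    also have "(\<lambda>n. \<Sum>i<m. norm (\<Sum>j<m. T i j n / w n)) = (\<lambda>n. ?f n / pow_growth d (norm a) n)"
      unfolding f w_def pow_growth_def
      by (simp add: norm_divide norm_mult norm_power flip: sum_divide_distrib)
    finally have "?f \<in> \<Theta>(pow_growth d (norm a))"
      using d 3 by (intro bigthetaI_tendsto[of "norm L"]) (auto simp: L_def)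
    then show ?thesis
      unfolding regular_growth_def using 3(1) zero_less_norm_iff by blast
  qed
qed

text \<open>Powers of a block diagonal matrix act blockwise, so the norm is a sum of nonnegative
  regular sequences, one for each block.\<close>

lemma regular_growth_jordan_matrix:
  fixes n_as :: "(nat \<times> complex) list"
  assumes "y \<in> carrier_vec (sum_list (map fst n_as))"
  shows "regular_growth (\<lambda>n. sum_norm (jordan_matrix n_as ^\<^sub>m n *\<^sub>v y))"
  using assms
proof (induction n_as arbitrary: y)
  case Nil
  then have "sum_norm (jordan_matrix [] ^\<^sub>m n *\<^sub>v y) = 0" for n
    unfolding sum_norm_def by simp
  then show ?case unfolding regular_growth_def by simp
next
  case (Cons na n_as)
  obtain m a where na: "na = (m, a)" by force
  let ?s = "sum_list (map fst n_as)"
  define u v where "u = vec_first y m" and "v = vec_last y ?s"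
  have u: "u \<in> carrier_vec m" and v: "v \<in> carrier_vec ?s" by (auto simp: u_def v_def)
  have y: "y = u @\<^sub>v v"
    unfolding u_def v_def using Cons.prems by (intro vec_first_last_append[symmetric]) (simp add: na)
  have "sum_norm (jordan_matrix (na # n_as) ^\<^sub>m n *\<^sub>v y)
      = sum_norm (jordan_block m a ^\<^sub>m n *\<^sub>v u) + sum_norm (jordan_matrix n_as ^\<^sub>m n *\<^sub>v v)" for n
  proof -
    have "jordan_matrix (na # n_as) ^\<^sub>m n =
        four_block_mat (jordan_block m a ^\<^sub>m n) (0\<^sub>m m ?s) (0\<^sub>m ?s m) (jordan_matrix n_as ^\<^sub>m n)"
      unfolding na jordan_matrix_Cons by (rule pow_four_block_mat) auto
    then show ?thesis
      unfolding y
      by (subst mult_mat_vec_split[OF _ _ u v, symmetric] sum_norm_append[symmetric])+ auto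
  qed
  then show ?case
    using regular_growth_jordan_block[OF u] Cons.IH[OF v]
    by (simp add: regular_growth_add sum_norm_nonneg)
qed

text \<open>If \<open>A = P * J * Q\<close> is a Jordan decomposition, then P and Q map the orbits
  of \<open>Q *\<^sub>v y\<close> under J and of y under A onto one another, so the two norms have
  the same order.\<close>

lemma regular_growth_mat_pow:
  fixes A :: "complex mat"
  assumes A: "A \<in> carrier_mat n n" and y: "y \<in> carrier_vec n"
  shows "regular_growth (\<lambda>k. sum_norm (A ^\<^sub>m k *\<^sub>v y))"
proof -
  obtain as where "char_poly A = (\<Prod>a\<leftarrow>as. [:- a, 1:])" using char_poly_factorized[OF A] by blast
  then obtain n_as where "jordan_nf A n_as" using jordan_nf_exists[OF A] by blast
  then obtain P Q where wit: "similar_mat_wit A (jordan_matrix n_as) P Q"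
    unfolding jordan_nf_def similar_mat_def by blast
  let ?J = "jordan_matrix n_as"
  note PQ = similar_mat_witD2[OF A wit]
  have n: "sum_list (map fst n_as) = n" using PQ(5) by auto
  have Qy: "Q *\<^sub>v y \<in> carrier_vec n" using PQ y by simp
  have Ak: "A ^\<^sub>m k *\<^sub>v y = P *\<^sub>v (?J ^\<^sub>m k *\<^sub>v (Q *\<^sub>v y))" for k
  proof -
    have "A ^\<^sub>m k = P * ?J ^\<^sub>m k * Q" by (rule similar_mat_wit_pow_id[OF wit])
    then show ?thesis using PQ y Qy by (simp add: assoc_mult_mat_vec[of _ n n _ n])
  qed
  have Jk: "?J ^\<^sub>m k *\<^sub>v (Q *\<^sub>v y) = Q *\<^sub>v (A ^\<^sub>m k *\<^sub>v y)" for k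
  proof -
    have J: "?J ^\<^sub>m k *\<^sub>v (Q *\<^sub>v y) \<in> carrier_vec n"
      using PQ Qy by (metis mult_mat_vec_carrier pow_carrier_mat)
    have "Q *\<^sub>v (A ^\<^sub>m k *\<^sub>v y) = (Q * P) *\<^sub>v (?J ^\<^sub>m k *\<^sub>v (Q *\<^sub>v y))"
      unfolding Ak by (rule assoc_mult_mat_vec[OF PQ(7,6) J, symmetric])
    then show ?thesis using PQ(2) J by simp
  qed
  have J: "?J ^\<^sub>m k *\<^sub>v (Q *\<^sub>v y) \<in> carrier_vec n" "A ^\<^sub>m k *\<^sub>v y \<in> carrier_vec n" for k
    using PQ(5) A y Qy by (metis mult_mat_vec_carrier pow_carrier_mat)+
  obtain c where c: "\<And>x. x \<in> carrier_vec n \<Longrightarrow> sum_norm (P *\<^sub>v x) \<le> c * sum_norm x"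
    using sum_norm_mult_mat_vec_le[OF PQ(6)] by blast
  obtain c' where c': "\<And>x. x \<in> carrier_vec n \<Longrightarrow> sum_norm (Q *\<^sub>v x) \<le> c' * sum_norm x"
    using sum_norm_mult_mat_vec_le[OF PQ(7)] by blast
  have "(\<lambda>k. sum_norm (A ^\<^sub>m k *\<^sub>v y)) \<in> O(\<lambda>k. sum_norm (?J ^\<^sub>m k *\<^sub>v (Q *\<^sub>v y)))"
    using c[OF J(1)] by (intro bigoI[of _ c]) (simp add: Ak sum_norm_nonneg)
  moreover have "(\<lambda>k. sum_norm (?J ^\<^sub>m k *\<^sub>v (Q *\<^sub>v y))) \<in> O(\<lambda>k. sum_norm (A ^\<^sub>m k *\<^sub>v y))"
    using c'[OF J(2)] by (intro bigoI[of _ c']) (simp add: Jk sum_norm_nonneg)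
  ultimately have "(\<lambda>k. sum_norm (A ^\<^sub>m k *\<^sub>v y)) \<in> \<Theta>(\<lambda>k. sum_norm (?J ^\<^sub>m k *\<^sub>v (Q *\<^sub>v y)))"
    by (intro bigthetaI) (simp_all add: bigomega_iff_bigo)
  moreover have "regular_growth (\<lambda>k. sum_norm (?J ^\<^sub>m k *\<^sub>v (Q *\<^sub>v y)))"
    using Qy n by (intro regular_growth_jordan_matrix) simp
  ultimately show ?thesis by (rule regular_growth_cong_bigtheta)
qed

section \<open>Row sums of powers\<close>

text \<open>Row sums arise here through the all-ones vector, because a left factor A then yields a
  one-step recursion.\<close>

definition row_growth :: "real mat \<Rightarrow> nat \<Rightarrow> nat \<Rightarrow> real" where
  "row_growth A i n = (A ^\<^sub>m n *\<^sub>v vec (dim_col A) (\<lambda>_. 1)) $ i"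

lemma row_growth_0:
  assumes "A \<in> carrier_mat N N" "i < N"
  shows "row_growth A i 0 = 1"
  using assms unfolding row_growth_def by simp

text \<open>Powers are defined by multiplication on the right, while the recursion for row sums
  peels off a factor on the left.\<close>

lemma pow_mat_Suc_left:
  fixes A :: "'a :: semiring_1 mat"
  assumes "A \<in> carrier_mat N N"
  shows "A ^\<^sub>m Suc n = A * A ^\<^sub>m n"
proof (induction n)
  case (Suc n)
  have "A ^\<^sub>m Suc (Suc n) = A * A ^\<^sub>m n * A" using Suc.IH by simp
  also have "\<dots> = A * (A ^\<^sub>m n * A)"
    using assms by (intro assoc_mult_mat[of _ N N _ N _ N]) auto
  finally show ?case by simp
qed (use assms in simp)

lemma row_growth_Suc:
  assumes "A \<in> carrier_mat N N" "i < N"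
  shows "row_growth A i (Suc n) = (\<Sum>j<N. A $$ (i,j) * row_growth A j n)"
proof -
  let ?v = "vec (dim_col A) (\<lambda>_. 1)"
  have v: "?v \<in> carrier_vec N" using assms by auto
  have "A ^\<^sub>m Suc n *\<^sub>v ?v = A *\<^sub>v (A ^\<^sub>m n *\<^sub>v ?v)"
    unfolding pow_mat_Suc_left[OF assms(1)] using assms v
    by (intro assoc_mult_mat_vec[of _ N N _ N]) auto
  then show ?thesis
    unfolding row_growth_def using assms by (simp add: scalar_prod_def lessThan_atLeast0)
qed

lemma nonneg_matD:
  assumes "nonneg_mat A" "A \<in> carrier_mat N N" "i < N" "j < N"
  shows "0 \<le> A $$ (i,j)"
  using assms unfolding nonneg_mat_def by auto

lemma row_growth_nonneg:
  assumes "nonneg_mat A" "A \<in> carrier_mat N N" "i < N"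
  shows "0 \<le> row_growth A i n"
  using assms(3)
proof (induction n arbitrary: i)
  case 0
  then show ?case using row_growth_0[OF assms(2)] by simp
next
  case (Suc n)
  then show ?case
    using row_growth_Suc[OF assms(2)] nonneg_matD[OF assms(1,2)] by (auto intro!: sum_nonneg)
qed

lemma row_growth_Suc_eq_0_iff:
  assumes "nonneg_mat A" "A \<in> carrier_mat N N" "i < N"
  shows "row_growth A i (Suc n) = 0 \<longleftrightarrow> (\<forall>j<N. A $$ (i,j) = 0 \<or> row_growth A j n = 0)"
  using assms row_growth_nonneg[OF assms(1,2)] nonneg_matD[OF assms(1,2)]
  by (subst row_growth_Suc[OF assms(2,3)], subst sum_nonneg_eq_0_iff) auto

text \<open>In the graph of nonzero entries the sum vanishes when no walk of length n starts at i;
  then no longer walk starts there either.\<close>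

lemma row_growth_eq_0_mono:
  assumes "nonneg_mat A" "A \<in> carrier_mat N N" "i < N" "row_growth A i n = 0" "n \<le> n'"
  shows "row_growth A i n' = 0"
proof -
  have "row_growth A i (Suc n) = 0" if "row_growth A i n = 0" "i < N" for i n
    using that
  proof (induction n arbitrary: i)
    case 0
    then show ?case using row_growth_0[OF assms(2)] by simp
  next
    case (Suc n)
    then show ?case using row_growth_Suc_eq_0_iff[OF assms(1,2)] by blast
  qed
  with assms(5,4,3) show ?thesis by (induction n' rule: dec_induct) auto
qed

lemma uniform_upper_bound:
  fixes f g :: "'a \<Rightarrow> real"
  assumes "finite I" "\<And>i. i \<in> I \<Longrightarrow> 0 \<le> g i" "\<And>i. i \<in> I \<Longrightarrow> g i = 0 \<Longrightarrow> f i \<le> 0"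
  obtains q where "1 \<le> q" "\<And>i. i \<in> I \<Longrightarrow> f i \<le> q * g i"
proof
  \<comment> \<open>Indices with \<open>g i = 0\<close> add nothing, as division by zero yields 0;
    the summand 1 secures \<open>1 \<le> ?q\<close>.\<close>
  let ?q = "1 + (\<Sum>i\<in>I. \<bar>f i / g i\<bar>)"
  show "1 \<le> ?q" by (simp add: sum_nonneg)
  fix i assume i: "i \<in> I"
  show "f i \<le> ?q * g i"
  proof (cases "g i = 0")
    case False
    have "f i / g i \<le> \<bar>f i / g i\<bar>" by (rule abs_ge_self)
    also have "\<dots> \<le> (\<Sum>i\<in>I. \<bar>f i / g i\<bar>)" using assms(1) i by (intro member_le_sum) auto
    also have "\<dots> \<le> ?q" by simp
    finally show ?thesis using False assms(2)[OF i] by (simp add: pos_divide_le_eq)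
  qed (use assms i in auto)
qed

section \<open>Combining the rows of two matrices\<close>

text \<open>A barrier \<open>m\<close> that C maps below its own next value carries an inequality at
  one time p to all later times. The delicate part is the start: \<open>row_growth C i p\<close>
  must vanish where \<open>m i p\<close> does, and \<open>V_nonzero\<close> serves this
  purpose.\<close>

lemma row_growth_combine:
  assumes carrier: "A \<in> carrier_mat N N" "B \<in> carrier_mat N N" "C \<in> carrier_mat N N"
    and nonneg: "nonneg_mat A" "nonneg_mat B" "nonneg_mat C"
    and C_A: "\<And>i j. i < N \<Longrightarrow> j < N \<Longrightarrow> i \<in> V \<Longrightarrow> C $$ (i,j) = A $$ (i,j)"
    and C_B: "\<And>i j. i < N \<Longrightarrow> j < N \<Longrightarrow> i \<notin> V \<Longrightarrow> C $$ (i,j) = B $$ (i,j)"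
    and V_small: "\<And>i. i < N \<Longrightarrow> i \<in> V \<Longrightarrow> row_growth A i \<in> o(row_growth B i)"
    and V_nonzero: "\<And>i n. i < N \<Longrightarrow> i \<in> V \<Longrightarrow> row_growth B i n \<noteq> 0"
    and not_V: "\<And>i. i < N \<Longrightarrow> i \<notin> V \<Longrightarrow> row_growth B i \<in> O(row_growth A i)"
  shows "\<exists>q>0. eventually (\<lambda>n. \<forall>i<N. row_growth C i n \<le> q * row_growth A i n
    \<and> row_growth C i n \<le> q * row_growth B i n) sequentially"
proof -
  note A_nonneg = row_growth_nonneg[OF nonneg(1) carrier(1)]
    and B_nonneg = row_growth_nonneg[OF nonneg(2) carrier(2)]
    and C_nonneg = row_growth_nonneg[OF nonneg(3) carrier(3)]
  have "\<exists>q>0. eventually (\<lambda>n. row_growth B i n \<le> q * row_growth A i n) sequentially"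
    if "i < N" "i \<notin> V" for i
    using not_V[OF that]
  proof (rule landau_o.bigE)
    fix c :: real
    assume "c > 0" "eventually (\<lambda>n. norm (row_growth B i n) \<le> c * norm (row_growth A i n)) sequentially"
    then show ?thesis using A_nonneg[OF that(1)] B_nonneg[OF that(1)] by auto
  qed
  then obtain Q' where Q': "\<And>i. i < N \<Longrightarrow> i \<notin> V \<Longrightarrow> Q' i > 0"
    "\<And>i. i < N \<Longrightarrow> i \<notin> V \<Longrightarrow> eventually (\<lambda>n. row_growth B i n \<le> Q' i * row_growth A i n) sequentially"
    by metis
  obtain Q where Q: "1 \<le> Q" "\<And>i. i \<in> {..<N} - V \<Longrightarrow> Q' i \<le> Q * 1"
    using uniform_upper_bound[of "{..<N} - V" "\<lambda>_. 1" Q'] by auto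
  \<comment> \<open>Q bounds all \<open>Q' i\<close>, so one factor fits every index off V;
    \<open>\<epsilon> \<le> 1\<close> later puts \<open>m\<close> below
    \<open>row_growth B\<close>.\<close>
  define \<epsilon> where "\<epsilon> = 1 / Q"
  have \<epsilon>: "0 < \<epsilon>" "\<epsilon> \<le> 1" unfolding \<epsilon>_def using Q(1) by auto
  have E1: "eventually (\<lambda>n. \<epsilon> * row_growth B i n \<le> row_growth A i n) sequentially"
    if "i < N" "i \<notin> V" for i
    using Q'(2)[OF that]
  proof eventually_elim
    case (elim n)
    also have "Q' i * row_growth A i n \<le> Q * row_growth A i n"
      using Q(2) that A_nonneg by (intro mult_right_mono) auto
    finally show ?case using Q(1) unfolding \<epsilon>_def by (simp add: field_simps)
  qed
  \<comment> \<open>Little-o allows any factor, so the \<open>\<epsilon>\<close> dictated by the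
    indices off V works here too.\<close>
  have E2: "eventually (\<lambda>n. row_growth A i n \<le> \<epsilon> * row_growth B i n) sequentially"
    if "i < N" "i \<in> V" for i
    using landau_o.smallD[OF V_small[OF that] \<epsilon>(1)] A_nonneg[OF that(1)] B_nonneg[OF that(1)] by simp
  \<comment> \<open>Zeros persist, so a late enough time reveals every sequence that ever reaches
    zero.\<close>
  have E3: "eventually (\<lambda>n. (\<exists>k. row_growth M i k = 0) \<longrightarrow> row_growth M i n = 0) sequentially"
    if "i < N" "nonneg_mat M" "M \<in> carrier_mat N N" for i M
  proof (cases "\<exists>k. row_growth M i k = 0")
    case True
    then obtain k where "row_growth M i k = 0" by blast
    then have "row_growth M i n = 0" if "k \<le> n" for n
      using row_growth_eq_0_mono[OF \<open>nonneg_mat M\<close> \<open>M \<in> carrier_mat N N\<close> \<open>i < N\<close>] that by blast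
    then show ?thesis unfolding eventually_sequentially by blast
  qed simp
  have "eventually (\<lambda>n. \<forall>i\<in>{..<N}. (i \<notin> V \<longrightarrow> \<epsilon> * row_growth B i n \<le> row_growth A i n)
      \<and> (i \<in> V \<longrightarrow> row_growth A i n \<le> \<epsilon> * row_growth B i n)
      \<and> ((\<exists>k. row_growth A i k = 0) \<longrightarrow> row_growth A i n = 0)
      \<and> ((\<exists>k. row_growth B i k = 0) \<longrightarrow> row_growth B i n = 0)) sequentially"
    using E1 E2 E3[OF _ nonneg(1) carrier(1)] E3[OF _ nonneg(2) carrier(2)]
    by (intro eventually_ball_finite ballI eventually_conj) auto
  then obtain n1 where n1: "\<And>n i. n1 \<le> n \<Longrightarrow> i < N \<Longrightarrow> (i \<notin> V \<longrightarrow> \<epsilon> * row_growth B i n \<le> row_growth A i n)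
      \<and> (i \<in> V \<longrightarrow> row_growth A i n \<le> \<epsilon> * row_growth B i n)
      \<and> ((\<exists>k. row_growth A i k = 0) \<longrightarrow> row_growth A i n = 0)
      \<and> ((\<exists>k. row_growth B i k = 0) \<longrightarrow> row_growth B i n = 0)"
    unfolding eventually_sequentially by (metis lessThan_iff)
  define m where "m i n = (if i \<in> V then row_growth A i n else \<epsilon> * row_growth B i n)" for i n
  have m_le: "m i n \<le> row_growth A i n" "m i n \<le> \<epsilon> * row_growth B i n" if "n1 \<le> n" "i < N" for i n
    using n1[OF that] unfolding m_def by auto
  have m_nonneg: "0 \<le> m i n" if "i < N" for i n
    using A_nonneg[OF that] B_nonneg[OF that] \<epsilon> unfolding m_def by auto
  \<comment> \<open>Row i of C comes from A or B. The matching bound in \<open>m_le\<close> replaces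
    \<open>m\<close> by the sequence of that matrix, and its recursion closes the estimate.\<close>
  have m_step: "(\<Sum>j<N. C $$ (i,j) * m j n) \<le> m i (Suc n)" if "n1 \<le> n" "i < N" for i n
  proof (cases "i \<in> V")
    case True
    have "(\<Sum>j<N. C $$ (i,j) * m j n) \<le> (\<Sum>j<N. A $$ (i,j) * row_growth A j n)"
      using that True C_A[of i] m_le(1)[of n] nonneg_matD[OF nonneg(1) carrier(1)]
      by (intro sum_mono) (auto intro!: mult_left_mono)
    then show ?thesis using True that row_growth_Suc[OF carrier(1)] by (simp add: m_def)
  next
    case False
    have "(\<Sum>j<N. C $$ (i,j) * m j n) \<le> (\<Sum>j<N. B $$ (i,j) * (\<epsilon> * row_growth B j n))"
      using that False C_B[of i] m_le(2)[of n] nonneg_matD[OF nonneg(2) carrier(2)]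
      by (intro sum_mono) (auto intro!: mult_left_mono)
    then show ?thesis
      using False that row_growth_Suc[OF carrier(2)] by (simp add: m_def sum_distrib_left mult_ac)
  qed
  txt \<open>To start the induction, \<open>C\<^sup>p 1\<close> must vanish wherever \<open>m\<close> does. Off \<open>V\<close> this propagates along \<open>B\<close>
    without ever entering \<open>V\<close>, as \<open>B\<^sup>n 1\<close> never vanishes there; on \<open>V\<close> it propagates along \<open>A\<close> until \<open>V\<close> is left.\<close>
  have zero_B: "row_growth C i n = 0" if "i < N" "i \<notin> V" "row_growth B i n = 0" for i n
    using that
  proof (induction n arbitrary: i)
    case 0
    then show ?case using row_growth_0[OF carrier(2)] by simp
  next
    case (Suc n)
    have "C $$ (i,j) = 0 \<or> row_growth C j n = 0" if "j < N" for j
    proof (cases "B $$ (i,j) = 0")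
      case True
      then show ?thesis using C_B Suc.prems that by simp
    next
      case False
      then have "row_growth B j n = 0"
        using Suc.prems row_growth_Suc_eq_0_iff[OF nonneg(2) carrier(2)] that by blast
      then show ?thesis using V_nonzero Suc.IH that by blast
    qed
    then show ?case using row_growth_Suc_eq_0_iff[OF nonneg(3) carrier(3)] Suc.prems by blast
  qed
  \<comment> \<open>The shift by \<open>n1\<close> leaves enough steps after an exit from V: at the
    exit index the sequence of B is only known to vanish from \<open>n1\<close> on.\<close>
  have zero_A: "row_growth C i (n + n1) = 0" if "i < N" "i \<in> V" "row_growth A i n = 0" for i n
    using that
  proof (induction n arbitrary: i)
    case 0
    then show ?case using row_growth_0[OF carrier(1)] by simp
  next
    case (Suc n)
    have "C $$ (i,j) = 0 \<or> row_growth C j (n + n1) = 0" if "j < N" for j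
    proof (cases "A $$ (i,j) = 0")
      case True
      then show ?thesis using C_A Suc.prems that by simp
    next
      case False
      then have A0: "row_growth A j n = 0"
        using Suc.prems row_growth_Suc_eq_0_iff[OF nonneg(1) carrier(1)] that by blast
      show ?thesis
      proof (cases "j \<in> V")
        case True
        then show ?thesis using A0 Suc.IH that by blast
      next
        case False
        \<comment> \<open>By time \<open>n1\<close> the sequence of A at j is already zero, and off
          V it dominates \<open>\<epsilon>\<close> times that of B.\<close>
        then have "\<epsilon> * row_growth B j n1 \<le> 0"
          using n1[of n1 j] A0 that by auto
        then have "row_growth B j n1 = 0"
          using \<epsilon> B_nonneg[OF that, of n1] by (simp add: mult_le_0_iff)
        then have "row_growth B j (n + n1) = 0"
          using row_growth_eq_0_mono[OF nonneg(2) carrier(2) that] le_add2 by blast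
        then show ?thesis using zero_B False that by blast
      qed
    qed
    then show ?case using row_growth_Suc_eq_0_iff[OF nonneg(3) carrier(3)] Suc.prems by simp
  qed
  \<comment> \<open>One \<open>n1\<close> is the time by which A has reached its zeros, the other is
    the shift in \<open>zero_A\<close>.\<close>
  define p where "p = n1 + n1"
  have zero_C: "row_growth C i p \<le> 0" if "i < N" "m i p = 0" for i
  proof (cases "i \<in> V")
    case True
    then have "row_growth A i n1 = 0" using n1[of n1 i] that unfolding m_def by auto
    then show ?thesis using zero_A True that unfolding p_def by simp
  next
    case False
    then have "row_growth B i p = 0" using that \<epsilon> unfolding m_def by simp
    then show ?thesis using zero_B False that by simp
  qed
  \<comment> \<open>This starts the induction; \<open>zero_C\<close> is what makes a finite constant
    possible.\<close>
  obtain q where q: "1 \<le> q" "\<And>i. i \<in> {..<N} \<Longrightarrow> row_growth C i p \<le> q * m i p"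
    by (rule uniform_upper_bound[of "{..<N}" "\<lambda>i. m i p" "\<lambda>i. row_growth C i p"])
      (use m_nonneg zero_C in auto)
  have C_le: "row_growth C i (p + k) \<le> q * m i (p + k)" if "i < N" for i k
    using that
  proof (induction k arbitrary: i)
    case 0
    then show ?case using q by simp
  next
    case (Suc k)
    have "row_growth C i (p + Suc k) = (\<Sum>j<N. C $$ (i,j) * row_growth C j (p + k))"
      using row_growth_Suc[OF carrier(3) Suc.prems] by simp
    also have "\<dots> \<le> (\<Sum>j<N. C $$ (i,j) * (q * m j (p + k)))"
      using Suc nonneg_matD[OF nonneg(3) carrier(3)] by (intro sum_mono mult_left_mono) auto
    also have "\<dots> = q * (\<Sum>j<N. C $$ (i,j) * m j (p + k))" by (simp add: sum_distrib_left mult_ac)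
    also have "\<dots> \<le> q * m i (p + Suc k)"
      using m_step[of "p + k" i] Suc.prems q(1) unfolding p_def by (intro mult_left_mono) auto
    finally show ?case .
  qed
  show ?thesis
  proof (intro exI[of _ q] conjI, use q(1) in simp,
      rule eventually_mono[OF eventually_ge_at_top[of p]], intro allI impI)
    fix n i assume n: "p \<le> n" and i: "i < N"
    have le: "row_growth C i n \<le> q * m i n" using C_le[OF i, of "n - p"] n by simp
    have "n1 \<le> n" using n by (simp add: p_def)
    note m_le = m_le[OF this i]
    have "m i n \<le> row_growth B i n"
      using m_le(2) mult_right_mono[OF \<epsilon>(2) B_nonneg[OF i, of n]] by simp
    with le m_le(1) q(1)
    show "row_growth C i n \<le> q * row_growth A i n \<and> row_growth C i n \<le> q * row_growth B i n"
      by (meson dual_order.trans mult_left_mono zero_le_one)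
  qed
qed

section \<open>Regularity of the row sums\<close>

lemma nonneg_mat_pow:
  assumes "nonneg_mat A" "A \<in> carrier_mat N N"
  shows "nonneg_mat (A ^\<^sub>m n)"
proof (induction n)
  case 0
  then show ?case using assms unfolding nonneg_mat_def by simp
next
  case (Suc n)
  have "A ^\<^sub>m n \<in> carrier_mat N N" using assms(2) by simp
  then show ?case
    using assms Suc unfolding nonneg_mat_def by (auto simp: scalar_prod_def intro!: sum_nonneg)
qed

lemma mult_mat_vec_mono:
  assumes "nonneg_mat M" "M \<in> carrier_mat N N" "x \<in> carrier_vec N" "y \<in> carrier_vec N" "x \<le> y"
  shows "M *\<^sub>v x \<le> M *\<^sub>v y"
  using assms nonneg_matD[OF assms(1,2)] unfolding less_eq_vec_def
  by (auto simp: scalar_prod_def intro!: sum_mono mult_left_mono)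

lemma transpose_mat_pow:
  fixes A :: "'a :: comm_semiring_1 mat"
  assumes "A \<in> carrier_mat N N"
  shows "A\<^sup>T ^\<^sub>m n = (A ^\<^sub>m n)\<^sup>T"
proof (induction n)
  case (Suc n)
  then have "A\<^sup>T ^\<^sub>m Suc n = (A ^\<^sub>m n)\<^sup>T * A\<^sup>T" by simp
  also have "\<dots> = (A * A ^\<^sub>m n)\<^sup>T"
    using assms by (intro transpose_mult[symmetric]) auto
  finally show ?case unfolding pow_mat_Suc_left[OF assms] .
qed (use assms in auto)

text \<open>Row \<open>i\<close> of \<open>A\<^sup>n\<close> is the orbit of the \<open>i\<close>th unit vector under the transpose, and as its entries are
  nonnegative, their sum is an \<open>\<ell>\<^sub>1\<close>-norm.\<close>

lemma regular_growth_row_growth: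
  assumes "nonneg_mat A" "A \<in> carrier_mat N N" "i < N"
  shows "regular_growth (row_growth A i)"
proof -
  define M where "M = (map_mat complex_of_real A)\<^sup>T"
  have "sum_norm (M ^\<^sub>m n *\<^sub>v unit_vec N i) = row_growth A i n" for n
  proof -
    have An: "A ^\<^sub>m n \<in> carrier_mat N N" using assms(2) by simp
    have "M ^\<^sub>m n = (map_mat complex_of_real (A ^\<^sub>m n))\<^sup>T"
      unfolding M_def using assms(2)
      by (subst transpose_mat_pow[of _ N]) (auto simp: of_real_hom.mat_hom_pow)
    moreover have "sum_norm ((map_mat complex_of_real X)\<^sup>T *\<^sub>v unit_vec N i) = (\<Sum>j<N. \<bar>X $$ (i,j)\<bar>)"
      if "X \<in> carrier_mat N N" for X
      using that assms(3) unfolding sum_norm_def by auto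
    ultimately have "sum_norm (M ^\<^sub>m n *\<^sub>v unit_vec N i) = (\<Sum>j<N. \<bar>(A ^\<^sub>m n) $$ (i,j)\<bar>)"
      using An by simp
    also have "\<dots> = (\<Sum>j<N. (A ^\<^sub>m n) $$ (i,j))"
      using nonneg_matD[OF nonneg_mat_pow[OF assms(1,2)] An assms(3)] by simp
    also have "\<dots> = row_growth A i n"
      unfolding row_growth_def using assms An by (simp add: scalar_prod_def lessThan_atLeast0)
    finally show ?thesis .
  qed
  then have "row_growth A i = (\<lambda>n. sum_norm (M ^\<^sub>m n *\<^sub>v unit_vec N i))" by auto
  moreover have "regular_growth (\<lambda>n. sum_norm (M ^\<^sub>m n *\<^sub>v unit_vec N i))"
    using assms(2) by (intro regular_growth_mat_pow[of _ N]) (auto simp: M_def)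
  ultimately show ?thesis by simp
qed

section \<open>Directedness and the least matrix\<close>

lemma product_property_lower_bound:
  assumes carrier: "K \<subseteq> carrier_mat N N" and nonneg: "\<And>A. A \<in> K \<Longrightarrow> nonneg_mat A"
    and "product_property N K" "A \<in> K" "B \<in> K"
  obtains C q where "C \<in> K" "q > 0" "eventually (\<lambda>n. \<forall>i<N. row_growth C i n \<le> q * row_growth A i n
    \<and> row_growth C i n \<le> q * row_growth B i n) sequentially"
proof -
  \<comment> \<open>Little-o can also hold when \<open>row_growth B i\<close> is eventually zero.
    The last clause leaves such rows to B, where the required big-O bound is trivial.\<close>
  define V where "V = {i. i < N \<and> row_growth A i \<in> o(row_growth B i) \<and> (\<forall>n. row_growth B i n \<noteq> 0)}"
  define C where "C = mat\<^sub>r N N (\<lambda>i. if i \<in> V then row A i else row B i)"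
  have AB: "A \<in> carrier_mat N N" "B \<in> carrier_mat N N" using assms by auto
  have "V \<subseteq> {..<N}" unfolding V_def by auto
  then have "C \<in> K"
    using assms(3-5) unfolding product_property_def C_def by simp
  have not_V: "row_growth B i \<in> O(row_growth A i)" if "i < N" "i \<notin> V" for i
  proof (cases "\<exists>k. row_growth B i k = 0")
    case True
    then obtain k where "row_growth B i k = 0" by blast
    then have "row_growth B i n = 0" if "k \<le> n" for n
      using row_growth_eq_0_mono[OF nonneg[OF \<open>B \<in> K\<close>] AB(2) \<open>i < N\<close>] that by blast
    then show ?thesis
      by (intro bigoI[of _ 1] eventually_mono[OF eventually_ge_at_top[of k]]) auto
  next
    case False
    then show ?thesis
      using that assms(4,5) regular_growth_total[of "row_growth A i" "row_growth B i"]
        regular_growth_row_growth[OF nonneg] AB unfolding V_def by blast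
  qed
  have C_index: "C $$ (i,j) = (if i \<in> V then A else B) $$ (i,j)" if "i < N" "j < N" for i j
    using that AB unfolding C_def by auto
  have "\<exists>q>0. eventually (\<lambda>n. \<forall>i<N. row_growth C i n \<le> q * row_growth A i n
    \<and> row_growth C i n \<le> q * row_growth B i n) sequentially"
  proof (rule row_growth_combine[where V = V])
    show "A \<in> carrier_mat N N" "B \<in> carrier_mat N N" by (fact AB)+
    show "C \<in> carrier_mat N N" using \<open>C \<in> K\<close> carrier by blast
    show "nonneg_mat A" "nonneg_mat B" "nonneg_mat C"
      using \<open>A \<in> K\<close> \<open>B \<in> K\<close> \<open>C \<in> K\<close> by (simp_all add: nonneg)
    show "C $$ (i,j) = A $$ (i,j)" if "i < N" "j < N" "i \<in> V" for i j
      using C_index that by simp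
    show "C $$ (i,j) = B $$ (i,j)" if "i < N" "j < N" "i \<notin> V" for i j
      using C_index that by simp
    show "row_growth A i \<in> o(row_growth B i)" if "i < N" "i \<in> V" for i
      using that unfolding V_def by blast
    show "row_growth B i n \<noteq> 0" if "i < N" "i \<in> V" for i n
      using that unfolding V_def by blast
  qed (fact not_V)
  with \<open>C \<in> K\<close> that show ?thesis by blast
qed

text \<open>Each induction step takes a common lower bound of the new matrix and the previous
  witness. The witness is sought in K rather than in F, because combining rows may leave F.\<close>

lemma product_property_minimal:
  assumes "K \<subseteq> carrier_mat N N" "\<And>A. A \<in> K \<Longrightarrow> nonneg_mat A" "product_property N K"
    and "finite F" "F \<noteq> {}" "F \<subseteq> K"
  shows "\<exists>B\<in>K. \<forall>A\<in>F. \<exists>q>0. eventually (\<lambda>n. \<forall>i<N. row_growth B i n \<le> q * row_growth A i n) sequentially"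
  using assms(4-6)
proof (induction F rule: finite_ne_induct)
  case (singleton A)
  then show ?case by (auto intro!: exI[of _ 1] bexI[of _ A])
next
  case (insert A F)
  then obtain B where "B \<in> K" and B: "\<And>A. A \<in> F \<Longrightarrow>
      \<exists>q>0. eventually (\<lambda>n. \<forall>i<N. row_growth B i n \<le> q * row_growth A i n) sequentially"
    by auto
  obtain C q where C: "C \<in> K" "q > 0" "eventually (\<lambda>n. \<forall>i<N. row_growth C i n \<le> q * row_growth A i n
    \<and> row_growth C i n \<le> q * row_growth B i n) sequentially"
    using product_property_lower_bound[OF assms(1-3)] insert.prems \<open>B \<in> K\<close> by blast
  have "\<exists>q>0. eventually (\<lambda>n. \<forall>i<N. row_growth C i n \<le> q * row_growth A' i n) sequentially"
    if A': "A' \<in> insert A F" for A'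
  proof (cases "A' = A")
    case True
    have "eventually (\<lambda>n. \<forall>i<N. row_growth C i n \<le> q * row_growth A' i n) sequentially"
      using C(3) by eventually_elim (simp add: True)
    then show ?thesis using C(2) by blast
  next
    case False
    with A' B obtain q' where q': "q' > 0"
      "eventually (\<lambda>n. \<forall>i<N. row_growth B i n \<le> q' * row_growth A' i n) sequentially" by blast
    have "eventually (\<lambda>n. \<forall>i<N. row_growth C i n \<le> q * q' * row_growth A' i n) sequentially"
      using C(3) q'(2)
    proof eventually_elim
      case (elim n)
      show ?case
      proof (intro allI impI)
        fix i assume "i < N"
        with elim have "row_growth C i n \<le> q * row_growth B i n"
          "q * row_growth B i n \<le> q * (q' * row_growth A' i n)" using C(2) by auto
        then show "row_growth C i n \<le> q * q' * row_growth A' i n" by (simp add: mult.assoc)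
      qed
    qed
    then show ?thesis using C(2) q'(1) by (intro exI[of _ "q * q'"]) simp
  qed
  with C(1) show ?case by blast
qed

section \<open>From row sums to positive vectors\<close>

text \<open>A strictly positive v lies between positive multiples of the all-ones vector, and
  nonnegative powers preserve these inequalities.\<close>

lemma growth_le_of_row_growth:
  assumes A: "nonneg_mat A" "A \<in> carrier_mat N N" and B: "nonneg_mat B" "B \<in> carrier_mat N N"
    and v: "v \<in> carrier_vec N" "strictly_positive_vec v"
    and "q > 0" and le: "eventually (\<lambda>n. \<forall>i<N. row_growth B i n \<le> q * row_growth A i n) sequentially"
  shows "(\<lambda>n. (B ^\<^sub>m n) *\<^sub>v v) \<preceq> (\<lambda>n. (A ^\<^sub>m n) *\<^sub>v v)"
proof -
  have v_pos: "0 < v $ i" if "i \<in> {..<N}" for i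
    using v that unfolding strictly_positive_vec_def by auto
  obtain a where a: "1 \<le> a" "\<And>i. i \<in> {..<N} \<Longrightarrow> v $ i \<le> a * 1"
    by (rule uniform_upper_bound[of "{..<N}" "\<lambda>_. 1" "\<lambda>i. v $ i"]) auto
  \<comment> \<open>Strict positivity enters here: where \<open>v $ i = 0\<close>, no b could
    work.\<close>
  obtain b where b: "1 \<le> b" "\<And>i. i \<in> {..<N} \<Longrightarrow> 1 \<le> b * v $ i"
    by (rule uniform_upper_bound[of "{..<N}" "\<lambda>i. v $ i" "\<lambda>_. 1"])
      (use v_pos in \<open>auto simp: less_le\<close>)
  let ?e = "vec N (\<lambda>_. 1 :: real)"
  have upper: "(B ^\<^sub>m n *\<^sub>v v) $ i \<le> a * row_growth B i n" if "i < N" for i n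
  proof -
    have "B ^\<^sub>m n *\<^sub>v v \<le> B ^\<^sub>m n *\<^sub>v (a \<cdot>\<^sub>v ?e)"
      using a v B by (intro mult_mat_vec_mono[of _ N] nonneg_mat_pow[of _ N]) (auto simp: less_eq_vec_def)
    then have "(B ^\<^sub>m n *\<^sub>v v) $ i \<le> (B ^\<^sub>m n *\<^sub>v (a \<cdot>\<^sub>v ?e)) $ i"
      using that B unfolding less_eq_vec_def by auto
    also have "B ^\<^sub>m n *\<^sub>v (a \<cdot>\<^sub>v ?e) = a \<cdot>\<^sub>v (B ^\<^sub>m n *\<^sub>v ?e)"
      using B by (intro mult_mat_vec[of _ N N]) auto
    finally show ?thesis using that B unfolding row_growth_def by auto
  qed
  have lower: "row_growth A i n \<le> b * (A ^\<^sub>m n *\<^sub>v v) $ i" if "i < N" for i n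
  proof -
    have "A ^\<^sub>m n *\<^sub>v ?e \<le> A ^\<^sub>m n *\<^sub>v (b \<cdot>\<^sub>v v)"
      using b v A by (intro mult_mat_vec_mono[of _ N] nonneg_mat_pow[of _ N]) (auto simp: less_eq_vec_def)
    also have "A ^\<^sub>m n *\<^sub>v (b \<cdot>\<^sub>v v) = b \<cdot>\<^sub>v (A ^\<^sub>m n *\<^sub>v v)"
      using A v by (intro mult_mat_vec[of _ N N]) auto
    finally show ?thesis
      using that A unfolding row_growth_def less_eq_vec_def by auto
  qed
  have "eventually (\<lambda>n. B ^\<^sub>m n *\<^sub>v v \<le> (a * q * b) \<cdot>\<^sub>v (A ^\<^sub>m n *\<^sub>v v)) sequentially"
    using le
  proof eventually_elim
    case (elim n)
    have "(B ^\<^sub>m n *\<^sub>v v) $ i \<le> a * q * b * (A ^\<^sub>m n *\<^sub>v v) $ i" if "i < N" for i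
    proof -
      have "(B ^\<^sub>m n *\<^sub>v v) $ i \<le> a * row_growth B i n" by (rule upper[OF that])
      also have "\<dots> \<le> a * (q * row_growth A i n)" using elim that a(1) by (intro mult_left_mono) auto
      also have "\<dots> \<le> a * (q * (b * (A ^\<^sub>m n *\<^sub>v v) $ i))"
        using lower[OF that] a(1) \<open>q > 0\<close> by (intro mult_left_mono) auto
      finally show ?thesis by (simp add: mult.assoc)
    qed
    then show ?case using A B unfolding less_eq_vec_def by auto
  qed
  moreover have "a * q * b > 0" using a(1) b(1) \<open>q > 0\<close> by simp
  ultimately show ?thesis unfolding growth_le_def by blast
qed

theorem lemma5:
  fixes N :: nat and K :: "real mat set"
  assumes "finite K" and "K \<noteq> {}"
    and "K \<subseteq> carrier_mat N N"
    and "\<And>A. A \<in> K \<Longrightarrow> nonneg_mat A"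
    and "product_property N K"
  shows "\<exists>B \<in> K. \<forall>A \<in> K. \<forall>v \<in> carrier_vec N. strictly_positive_vec v \<longrightarrow>
           (\<lambda>n. (B ^\<^sub>m n) *\<^sub>v v) \<preceq> (\<lambda>n. (A ^\<^sub>m n) *\<^sub>v v)"
proof -
  \<comment> \<open>The comparison of row sums does not involve v, so the matrix found with
    \<open>F = K\<close> serves for all v at once.\<close>
  obtain B where "B \<in> K" and B: "\<And>A. A \<in> K \<Longrightarrow>
      \<exists>q>0. eventually (\<lambda>n. \<forall>i<N. row_growth B i n \<le> q * row_growth A i n) sequentially"
    using product_property_minimal[OF assms(3-5) assms(1,2)] by blast
  show ?thesis
  proof (intro bexI[OF _ \<open>B \<in> K\<close>] ballI impI)
    fix A v
    assume "A \<in> K" and v: "v \<in> carrier_vec N" "strictly_positive_vec v"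
    moreover obtain q where "q > 0"
      "eventually (\<lambda>n. \<forall>i<N. row_growth B i n \<le> q * row_growth A i n) sequentially"
      using B[OF \<open>A \<in> K\<close>] by blast
    ultimately show "(\<lambda>n. (B ^\<^sub>m n) *\<^sub>v v) \<preceq> (\<lambda>n. (A ^\<^sub>m n) *\<^sub>v v)"
      using \<open>B \<in> K\<close> assms(3,4) by (intro growth_le_of_row_growth[of A N B]) auto
  qed
qed

end
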